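(* Let $\mathfrak{w}$ be a form on the complex linear space $\mathfrak{X}$, and consider the set $\mathrm{Q}(\mathfrak{w})$ of $\mathfrak{w}$-quasi-units. Then the partially ordered set $(\mathrm{Q}(\mathfrak{w}),\leq)$ is a lattice. Namely, if $\mathfrak{s}$ and $\mathfrak{t}$ are $\mathfrak{w}$-quasi-units, then the greatest lower bound $\mathfrak{s}\curlywedge\mathfrak{t}$ and the least upper bound $\mathfrak{s}\curlyvee\mathfrak{t}$ in $\mathrm{Q}(\mathfrak{w})$ exist, and $$\mathfrak{s}\curlywedge\mathfrak{t}=2(\mathfrak{s}:\mathfrak{t}),\qquad \mathfrak{s}\curlyvee\mathfrak{t}=\mathbf{D}_{\mathfrak{s}+\mathfrak{t}}\mathfrak{w}.$$ Furthermore, $\mathfrak{s}\curlywedge\mathfrak{t}=\mathfrak{s}\wedge\mathfrak{t}=\mathbf{D}_{\mathfrak{s}}\mathfrak{t}=\mathbf{D}_{\mathfrak{t}}\mathfrak{s}$, where $\mathfrak{s}\wedge\mathfrak{t}$ denotes the greatest lower bound of $\mathfrak{s}$ and $\mathfrak{t}$ in $\mathcal{F}_+(\mathfrak{X})$ (which in particular exists).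
   Context: A form on the complex linear space $\mathfrak{X}$ is a nonnegative sesquilinear form $\mathfrak{t}:\mathfrak{X}\times\mathfrak{X}\to\mathbb{C}$ (linear in the first, antilinear in the second variable, $\mathfrak{t}[x]:=\mathfrak{t}(x,x)\geq 0$ for all $x$). $\mathcal{F}_+(\mathfrak{X})$ is the set of all forms on $\mathfrak{X}$, ordered by $\mathfrak{t}\leq\mathfrak{w}$ iff $\mathfrak{t}[x]\leq\mathfrak{w}[x]$ for all $x\in\mathfrak{X}$. Parallel sum of forms: $\mathfrak{t}:\mathfrak{w}$ is the form with quadratic form $(\mathfrak{t}:\mathfrak{w})[x]=\inf_{y\in\mathfrak{X}}\{\mathfrak{t}[x-y]+\mathfrak{w}[y]\}$. For forms $\mathfrak{t},\mathfrak{w}$, the form $\mathbf{D}_{\mathfrak{w}}\mathfrak{t}:=\sup_{n\in\mathbb{N}}\mathfrak{t}:(n\mathfrak{w})$ is the pointwise limit of the increasing sequence $(\mathfrak{t}:(n\mathfrak{w}))_n$, which is bounded above by $\mathfrak{t}$. A form $\mathfrak{t}$ with $\mathfrak{t}\leq\mathfrak{w}$ is a $\mathfrak{w}$-quasi-unit if $\mathbf{D}_{\mathfrak{t}}\mathfrak{w}=\mathfrak{t}$; $\mathrm{Q}(\mathfrak{w})$ is the set of all $\mathfrak{w}$-quasi-units, ordered by $\leq$. *)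

theory Defs
  imports Complex_Main "HOL-Algebra.Lattice"
begin

text \<open>
  A complex linear space is a type \<open>'a\<close> together with a scalar multiplication
  \<open>scale :: complex \<Rightarrow> 'a \<Rightarrow> 'a\<close> satisfying \<^const>\<open>vector_space\<close>.
\<close>

type_synonym 'a sform = "'a \<Rightarrow> 'a \<Rightarrow> complex"

definition is_form :: "(complex \<Rightarrow> 'a \<Rightarrow> 'a::ab_group_add) \<Rightarrow> 'a sform \<Rightarrow> bool" where
  "is_form scale t \<longleftrightarrow>
     (\<forall>x y z. t (x + y) z = t x z + t y z) \<and>
     (\<forall>c x y. t (scale c x) y = c * t x y) \<and>
     (\<forall>x y z. t x (y + z) = t x y + t x z) \<and>
     (\<forall>c x y. t x (scale c y) = cnj c * t x y) \<and>
     (\<forall>x. t x x \<in> \<real> \<and> 0 \<le> Re (t x x))"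

definition quad :: "'a sform \<Rightarrow> 'a \<Rightarrow> real" where
  "quad t x = Re (t x x)"

definition form_le :: "'a sform \<Rightarrow> 'a sform \<Rightarrow> bool" where
  "form_le t w \<longleftrightarrow> (\<forall>x. quad t x \<le> quad w x)"

definition form_add :: "'a sform \<Rightarrow> 'a sform \<Rightarrow> 'a sform" where
  "form_add t w = (\<lambda>x y. t x y + w x y)"

definition form_mult :: "nat \<Rightarrow> 'a sform \<Rightarrow> 'a sform" where
  "form_mult n t = (\<lambda>x y. of_nat n * t x y)"

text \<open>
  By polarization a form is determined by its quadratic form, so there is at most one
  candidate in each of the following two definite descriptions. The infimum is over a nonempty
  set bounded below by \<open>0\<close>, the supremum over a nonempty set bounded above by \<open>quad t x\<close>.
  The term \<open>n = 0\<close> of the supremum is \<open>0\<close> and hence immaterial.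
\<close>

definition parallel_sum ::
    "(complex \<Rightarrow> 'a \<Rightarrow> 'a::ab_group_add) \<Rightarrow> 'a sform \<Rightarrow> 'a sform \<Rightarrow> 'a sform" where
  "parallel_sum scale t w =
     (THE u. is_form scale u \<and> (\<forall>x. quad u x = (INF y. quad t (x - y) + quad w y)))"

text \<open>\<open>form_D scale w t\<close> is \<open>D\<^sub>w t\<close>.\<close>

definition form_D ::
    "(complex \<Rightarrow> 'a \<Rightarrow> 'a::ab_group_add) \<Rightarrow> 'a sform \<Rightarrow> 'a sform \<Rightarrow> 'a sform" where
  "form_D scale w t =
     (THE u. is_form scale u \<and>
        (\<forall>x. quad u x = (SUP n. quad (parallel_sum scale t (form_mult n w)) x)))"

definition quasi_units ::
    "(complex \<Rightarrow> 'a \<Rightarrow> 'a::ab_group_add) \<Rightarrow> 'a sform \<Rightarrow> 'a sform set" where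
  "quasi_units scale w = {t. is_form scale t \<and> form_le t w \<and> form_D scale t w = t}"

definition form_order :: "(complex \<Rightarrow> 'a \<Rightarrow> 'a::ab_group_add) \<Rightarrow> 'a sform gorder" where
  "form_order scale = \<lparr>carrier = {t. is_form scale t}, eq = (=), le = form_le\<rparr>"

definition quasi_unit_order ::
    "(complex \<Rightarrow> 'a \<Rightarrow> 'a::ab_group_add) \<Rightarrow> 'a sform \<Rightarrow> 'a sform gorder" where
  "quasi_unit_order scale w = \<lparr>carrier = quasi_units scale w, eq = (=), le = form_le\<rparr>"

end

theory Submission
  imports Defs
begin

text \<open>
  In the Hilbert space of \<open>w\<close> the quasi-units are the orthogonal projections. Instead of completing,
  one approximates the projection of \<open>x\<close> by a sequence \<open>y\<close>: a form \<open>t \<le> w\<close> is a quasi-unit iff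
  every \<open>x\<close> admits \<open>y\<close> with \<open>t[x - y n] \<rightarrow> 0\<close> and \<open>w[y n] - t[y n] \<rightarrow> 0\<close>. Minimizing
  \<open>w[x - z] + n u[z]\<close> yields such sequences for \<open>D\<^sub>u w\<close>, which is thus always a quasi-unit and
  provides the join for \<open>u = s + t\<close>.

  For the meet, \<open>e = D\<^sub>s t\<close> satisfies \<open>e \<le> D\<^sub>s w = s\<close> and \<open>e \<le> t\<close>, and dominates every common lower
  bound. In particular \<open>p = s : t \<le> e\<close>, and also \<open>D\<^sub>e w \<le> e\<close>, so \<open>e\<close> is a quasi-unit. Splitting
  \<open>y\<close> in half gives \<open>2 p[y] \<le> w[y]\<close>; along the sequence approximating the projection of \<open>x\<close> for \<open>e\<close>
  the form \<open>p\<close> neglects \<open>x - y n\<close> and \<open>w[y n]\<close> tends to \<open>e[x]\<close>, hence \<open>2 p \<le> e\<close>.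
\<close>

section \<open>Null sequences and additive functions on the reals\<close>

lemma LIMSEQ_null_squeeze:
  fixes f g :: "nat \<Rightarrow> real"
  assumes "g \<longlonglongrightarrow> 0" "\<And>n. 0 \<le> f n" "\<And>n. f n \<le> g n"
  shows "f \<longlonglongrightarrow> 0"
  by (rule tendsto_sandwich[OF _ _ tendsto_const assms(1)]) (simp_all add: assms(2,3))

text \<open>Subtracting \<open>x * f 1\<close> leaves an additive function that vanishes on the
  integers, hence is periodic with period 1 and bounded on the whole line. Since its value at
  \<open>n * r\<close> is \<open>n\<close> times the value at \<open>r\<close>, boundedness forces
  it to be 0. This supplies real homogeneity in \<open>jordan_von_neumann\<close>.\<close>

lemma additive_locally_bounded_linear:
  fixes f :: "real \<Rightarrow> real"
  assumes add: "\<And>x y. f (x + y) = f x + f y"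
    and bdd: "\<And>x. \<bar>x\<bar> \<le> 1 \<Longrightarrow> \<bar>f x\<bar> \<le> C"
  shows "f r = r * f 1"
proof -
  define g where "g x = f x - x * f 1" for x
  have g_add: "g (x + y) = g x + g y" for x y
    by (simp add: g_def add algebra_simps)
  have g0: "g 0 = 0" using g_add[of 0 0] by simp
  have g_minus: "g (- x) = - g x" for x using g_add[of x "- x"] g0 by simp
  have g_nat: "g (of_nat n * x) = of_nat n * g x" for n x
    by (induction n) (simp_all add: g0 g_add algebra_simps)
  have g_int: "g (of_int k) = 0" for k
    using g_nat[of "nat k" 1] g_nat[of "nat (- k)" 1] g_minus[of "of_int k"]
    by (cases "k \<ge> 0") (auto simp: g_def)
  have g_bdd: "\<bar>g x\<bar> \<le> C + \<bar>f 1\<bar>" for x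
  proof -
    have "g x = g (of_int \<lfloor>x\<rfloor> + frac x)" by (simp add: frac_def)
    also have "\<dots> = g (frac x)" by (simp add: g_add g_int)
    finally have eq: "g x = g (frac x)" .
    have "0 \<le> frac x" "frac x \<le> 1"
      using frac_ge_0[of x] frac_lt_1[of x] by auto
    then have "\<bar>frac x * f 1\<bar> \<le> \<bar>f 1\<bar>" "\<bar>f (frac x)\<bar> \<le> C"
      using mult_left_le_one_le[of "\<bar>f 1\<bar>" "frac x"] by (auto simp: abs_mult intro: bdd)
    then show ?thesis unfolding eq by (simp add: g_def)
  qed
  have "g r = 0"
  proof (rule ccontr)
    assume "g r \<noteq> 0"
    then obtain n :: nat where "C + \<bar>f 1\<bar> < of_nat n * \<bar>g r\<bar>"
      using reals_Archimedean3[of "\<bar>g r\<bar>"] by auto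
    also have "\<dots> = \<bar>g (of_nat n * r)\<bar>" by (simp add: g_nat abs_mult)
    finally show False using g_bdd[of "of_nat n * r"] by linarith
  qed
  then show ?thesis by (simp add: g_def)
qed

locale complex_space = vector_space scale
  for scale :: "complex \<Rightarrow> 'a \<Rightarrow> 'a::ab_group_add"
begin

subsection \<open>Forms and quadratic functions\<close>

text \<open>By the Jordan-von Neumann theorem these are exactly the diagonals of forms. Checking
  this predicate shows that the definite descriptions in \<open>parallel_sum\<close> and
  \<open>form_D\<close> denote forms.\<close>

definition quadratic :: "('a \<Rightarrow> real) \<Rightarrow> bool" where
  "quadratic q \<longleftrightarrow> (\<forall>x. 0 \<le> q x) \<and>
     (\<forall>x y. q (x + y) + q (x - y) = 2 * q x + 2 * q y) \<and>
     (\<forall>c x. q (scale c x) = (cmod c)\<^sup>2 * q x)"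

lemma scale_minus_one: "scale (- 1) x = - x"
  by simp

lemma form_minus:
  assumes "is_form scale t"
  shows "t (- x) y = - t x y" "t x (- y) = - t x y"
  using assms unfolding is_form_def
  by (metis scale_minus_one mult_minus1, metis scale_minus_one mult_minus1 complex_cnj_minus complex_cnj_one)

lemma form_diff:
  assumes "is_form scale t"
  shows "t (x - y) z = t x z - t y z" "t x (y - z) = t x y - t x z"
  using assms form_minus[OF assms] unfolding is_form_def
  by (metis diff_conv_add_uminus)+

lemma quad_nonneg: "is_form scale t \<Longrightarrow> 0 \<le> quad t x"
  by (simp add: is_form_def quad_def)

lemma quad_scale: "is_form scale t \<Longrightarrow> quad t (scale c x) = (cmod c)\<^sup>2 * quad t x"
  by (simp add: is_form_def quad_def mult.assoc[symmetric] complex_mult_cnj) (simp add: cmod_power2 flip: power2_eq_square)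

lemma quad_parallelogram:
  "is_form scale t \<Longrightarrow> quad t (x + y) + quad t (x - y) = 2 * quad t x + 2 * quad t y"
  by (simp add: quad_def form_diff) (simp add: is_form_def)

lemma quad_zero: "is_form scale t \<Longrightarrow> quad t 0 = 0"
  using quad_scale[of t 0 0] by simp

lemma quad_minus: "is_form scale t \<Longrightarrow> quad t (- x) = quad t x"
  using quad_scale[of t "- 1" x] by simp

lemma quad_diff_commute: "is_form scale t \<Longrightarrow> quad t (x - y) = quad t (y - x)"
  by (metis quad_minus minus_diff_eq)

text \<open>Polarization recovers \<open>v x y\<close> from the diagonal, and the diagonal values
  are real, so that \<open>quad\<close> determines them.\<close>

lemma form_eqI:
  assumes t: "is_form scale t" and u: "is_form scale u" and eq: "\<And>x. quad t x = quad u x"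
  shows "t = u"
proof (intro ext)
  fix x y
  have diag: "t z z = u z z" for z
    using t u eq[of z] by (auto simp: is_form_def quad_def complex_eq_iff complex_is_Real_iff)
  have polar: "4 * v x y = v (x + y) (x + y) - v (x - y) (x - y)
      + \<i> * v (x + scale \<i> y) (x + scale \<i> y) - \<i> * v (x - scale \<i> y) (x - scale \<i> y)"
    if "is_form scale v" for v
    using that by (simp add: form_diff[OF that]) (simp add: is_form_def algebra_simps)
  show "t x y = u x y"
    using polar[OF t] polar[OF u] unfolding diag by (metis mult_left_cancel zero_neq_numeral)
qed

lemma form_leD: "form_le t u \<Longrightarrow> quad t x \<le> quad u x"
  by (simp add: form_le_def)

lemma form_le_refl: "form_le t t"
  by (simp add: form_le_def)

lemma form_le_trans: "form_le t u \<Longrightarrow> form_le u v \<Longrightarrow> form_le t v"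
  unfolding form_le_def by (meson order_trans)

lemma form_le_antisym:
  "is_form scale t \<Longrightarrow> is_form scale u \<Longrightarrow> form_le t u \<Longrightarrow> form_le u t \<Longrightarrow> t = u"
  by (rule form_eqI) (auto simp: form_le_def intro: antisym)

lemma is_form_mult: "is_form scale t \<Longrightarrow> is_form scale (form_mult n t)"
  by (simp add: is_form_def form_mult_def algebra_simps)

lemma quad_mult: "quad (form_mult n t) x = real n * quad t x"
  by (simp add: quad_def form_mult_def)

lemma is_form_add: "is_form scale t \<Longrightarrow> is_form scale u \<Longrightarrow> is_form scale (form_add t u)"
  by (simp add: is_form_def form_add_def algebra_simps)

lemma quad_add: "quad (form_add t u) x = quad t x + quad u x"
  by (simp add: quad_def form_add_def)

section \<open>Cauchy-Schwarz and continuity of quadratic forms\<close>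

lemma quad_expand:
  assumes "is_form scale t"
  shows "quad t (x + scale (of_real r) y) = quad t x + r * (Re (t x y) + Re (t y x)) + r\<^sup>2 * quad t y"
  using assms by (simp add: is_form_def quad_def algebra_simps power2_eq_square)

lemma quad_expand_one:
  assumes "is_form scale t"
  shows "quad t (x + y) = quad t x + (Re (t x y) + Re (t y x)) + quad t y"
  using quad_expand[OF assms, of x 1 y] by simp

text \<open>The polynomial \<open>quad_expand\<close> in \<open>r\<close> is nonnegative, so its
  discriminant is not positive. Its middle coefficient equals \<open>2 * Re (t x y)\<close> by
  Hermitian symmetry.\<close>

lemma cauchy_schwarz:
  assumes t: "is_form scale t"
  shows "\<bar>Re (t x y) + Re (t y x)\<bar> \<le> 2 * sqrt (quad t x) * sqrt (quad t y)"
proof -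
  define c where "c = Re (t x y) + Re (t y x)"
  have nonneg: "0 \<le> quad t x + r * c + r\<^sup>2 * quad t y" for r
    using quad_expand[OF t, of x r y] quad_nonneg[OF t] by (metis c_def)
  have "c\<^sup>2 \<le> 4 * quad t x * quad t y"
  proof (cases "quad t y = 0")
    case True
    have "c = 0"
    proof (rule ccontr)
      assume "c \<noteq> 0"
      then show False
        \<comment> \<open>Here the polynomial is affine in \<open>r\<close>, and this
          \<open>r\<close> gives it the value -1.\<close>
        using nonneg[of "- (quad t x + 1) / c"] True by (simp add: field_simps)
    qed
    then show ?thesis using True by simp
  next
    case False
    then have pos: "0 < quad t y" using quad_nonneg[OF t, of y] by simp
    \<comment> \<open>The value of \<open>r\<close> inserted here is the minimizer of the
      polynomial.\<close>
    have "0 \<le> 4 * quad t y * (quad t x + (- c / (2 * quad t y)) * c + (- c / (2 * quad t y))\<^sup>2 * quad t y)"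
      using pos by (intro mult_nonneg_nonneg nonneg) auto
    also have "\<dots> = 4 * quad t x * quad t y - c\<^sup>2"
      using False by (simp add: field_simps power2_eq_square)
    finally show ?thesis by simp
  qed
  then have "\<bar>c\<bar> \<le> sqrt (4 * quad t x * quad t y)"
    by (simp add: real_le_rsqrt)
  then show ?thesis by (simp add: real_sqrt_mult c_def)
qed

lemma quad_tendsto:
  assumes t: "is_form scale t" and lim: "(\<lambda>n. quad t (x - y n)) \<longlonglongrightarrow> 0"
  shows "(\<lambda>n. quad t (y n)) \<longlonglongrightarrow> quad t x"
proof -
  have bound: "\<bar>quad t (y n) - quad t x\<bar> \<le> quad t (x - y n) + 2 * sqrt (quad t x) * sqrt (quad t (x - y n))" for n
    using quad_expand_one[OF t, of x "y n - x"] cauchy_schwarz[OF t, of x "y n - x"]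
      quad_diff_commute[OF t, of x "y n"] quad_nonneg[OF t, of "x - y n"]
    by (simp add: abs_le_iff)
  have "(\<lambda>n. quad t (x - y n) + 2 * sqrt (quad t x) * sqrt (quad t (x - y n))) \<longlonglongrightarrow>
      0 + 2 * sqrt (quad t x) * sqrt 0"
    by (intro tendsto_intros lim)
  then have upper: "(\<lambda>n. quad t (x - y n) + 2 * sqrt (quad t x) * sqrt (quad t (x - y n))) \<longlonglongrightarrow> 0"
    by simp
  have "(\<lambda>n. quad t (y n) - quad t x) \<longlonglongrightarrow> 0"
    by (rule tendsto_rabs_zero_cancel, rule tendsto_sandwich[OF _ _ tendsto_const upper])
      (auto simp: bound)
  then show ?thesis by (simp add: LIM_zero_iff)
qed

text \<open>The right side minus the left side is \<open>quad t\<close> at \<open>x\<close> minus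
  \<open>n\<close> times \<open>y\<close>. In terms of parallel sums this bounds t : (n t) from
  below by n/(n+1) t.\<close>

lemma quad_add_weighted:
  assumes t: "is_form scale t"
  shows "real n * quad t (x + y) \<le> (real n + 1) * (quad t x + real n * quad t y)"
proof -
  have "0 \<le> quad t x + (- real n) * (Re (t x y) + Re (t y x)) + (- real n)\<^sup>2 * quad t y"
    using quad_expand[OF t, of x "- real n" y] quad_nonneg[OF t] by metis
  then show ?thesis
    unfolding quad_expand_one[OF t]
    by (simp add: algebra_simps power2_eq_square)
qed

lemma quad_add_le: "is_form scale t \<Longrightarrow> quad t (x + y) \<le> 2 * (quad t x + quad t y)"
  using quad_add_weighted[of t 1 x y] by simp

text \<open>Real polarization of \<open>q\<close> gives a symmetric \<open>B\<close>. The
  parallelogram law makes it additive, local boundedness makes it real linear, and homogeneity of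
  \<open>q\<close> makes it invariant under multiplying both arguments by \<i>. The form is then the
  complexification of \<open>B\<close>.\<close>

lemma jordan_von_neumann:
  assumes "quadratic q"
  shows "\<exists>t. is_form scale t \<and> quad t = q"
proof -
  have nonneg: "0 \<le> q x" and par: "q (x + y) + q (x - y) = 2 * q x + 2 * q y"
    and hom: "q (scale c x) = (cmod c)\<^sup>2 * q x" for x y c
    using assms by (auto simp: quadratic_def)
  have q0: "q 0 = 0" using hom[of 0 0] by simp
  have qm: "q (- x) = q x" for x using hom[of "- 1" x] by simp
  define B where "B x y = (q (x + y) - q (x - y)) / 4" for x y
  have B_sym: "B x y = B y x" for x y
    using qm[of "x - y"] by (simp add: B_def add.commute)
  have B0: "B 0 y = 0" for y by (simp add: B_def qm)
  have B_pair: "B (x + z) y + B (x - z) y = 2 * B x y" for x y z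
    using par[of "x + y" z] par[of "x - y" z]
    by (simp add: B_def field_simps)
  have B_add: "B (x + z) y = B x y + B z y" for x y z
  proof -
    \<comment> \<open>With \<open>x = a + b\<close> and \<open>z = a - b\<close>, the identity
      \<open>B_pair\<close> evaluates \<open>B x y + B z y\<close> as \<open>2 * B a y\<close>; for
      the pair \<open>a\<close>, \<open>a\<close> it gives the same value for
      \<open>B (x + z) y\<close>.\<close>
    define a where "a = scale (1/2) (x + z)"
    define b where "b = scale (1/2) (x - z)"
    have double: "scale (1/2) u + scale (1/2) u = u" for u
      using scale_left_distrib[of "1/2" "1/2" u] by simp
    have "a + b = x" "a - b = z" "a + a = x + z"
      using double[of x] double[of z] double[of "x + z"]
      by (simp_all add: a_def b_def scale_right_distrib scale_right_diff_distrib algebra_simps)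
    then show ?thesis
      using B_pair[of a b y] B_pair[of a a y] B0[of y] by simp
  qed
  have B_minus: "B (- x) y = - B x y" for x y
    using B_add[of x "- x" y] B0[of y] by simp
  have B_real: "B (scale (of_real r) x) y = r * B x y" for r x y
  proof -
    have "B (scale (of_real r) x) y = r * B (scale (of_real 1) x) y"
    \<comment> \<open>The constant comes from the parallelogram law: both terms of \<open>B\<close>
      are nonnegative, so their sum bounds their difference.\<close>
    proof (rule additive_locally_bounded_linear[where C = "q x + q y"])
      show "B (scale (of_real (a + b)) x) y = B (scale (of_real a) x) y + B (scale (of_real b) x) y" for a b
        by (simp add: scale_left_distrib B_add)
      show "\<bar>B (scale (of_real a) x) y\<bar> \<le> q x + q y" if "\<bar>a\<bar> \<le> 1" for a
      proof -
        have "q (scale (of_real a) x) \<le> q x"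
          using that nonneg[of x] by (simp add: hom abs_square_le_1 mult_left_le_one_le)
        moreover have "4 * \<bar>B (scale (of_real a) x) y\<bar> \<le> q (scale (of_real a) x + y) + q (scale (of_real a) x - y)"
          using nonneg[of "scale (of_real a) x + y"] nonneg[of "scale (of_real a) x - y"]
          by (simp add: B_def)
        ultimately show ?thesis using nonneg[of x] nonneg[of y] unfolding par by linarith
      qed
    qed
    then show ?thesis by simp
  qed
  have B_i_i: "B (scale \<i> x) (scale \<i> y) = B x y" for x y
    using hom[of \<i> "x + y"] hom[of \<i> "x - y"]
    by (simp add: B_def scale_right_distrib scale_right_diff_distrib)
  have B_i: "B (scale \<i> x) y = - B x (scale \<i> y)" for x y
    using B_i_i[of "scale \<i> x" y] by (simp add: B_minus)
  have B_diag_i: "B x (scale \<i> x) = 0" for x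
    using B_sym[of x "scale \<i> x"] B_i[of x x] by simp
  \<comment> \<open>The imaginary part is forced: antilinearity in the second variable makes Im t(x,
    y) the real part of t(x, \<i> y).\<close>
  define t where "t x y = Complex (B x y) (B x (scale \<i> y))" for x y
  have decomp: "scale c x = scale (of_real (Re c)) x + scale (of_real (Im c)) (scale \<i> x)" for c x
    using scale_left_distrib[of "of_real (Re c)" "of_real (Im c) * \<i>" x] complex_eq[of c]
    by (simp add: mult.commute)
  have B_add_right: "B x (y + z) = B x y + B x z"
    and B_real_right: "B x (scale (of_real r) y) = r * B x y" for x y z r
    using B_add[of y z x] B_real[of r y x] by (simp_all add: B_sym[of x])
  have B_minus_right: "B x (- y) = - B x y" for x y
    using B_minus[of y x] by (simp add: B_sym[of x])
  have B_i_i2: "B x (scale \<i> (scale \<i> y)) = - B x y" for x y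
    by (simp add: B_minus_right)
  have comm_i: "scale \<i> (scale (of_real r) x) = scale (of_real r) (scale \<i> x)" for r x
    by (rule scale_left_commute)
  have "is_form scale t"
    unfolding is_form_def
  proof (intro conjI allI)
    fix x y z c
    show "t (x + y) z = t x z + t y z" "t x (y + z) = t x y + t x z"
      by (simp_all add: t_def complex_eq_iff B_add B_add_right scale_right_distrib)
    show "t (scale c x) y = c * t x y"
      by (subst decomp) (simp add: t_def complex_eq_iff B_add B_real B_i B_i_i2 algebra_simps del: scale_scale)
    show "t x (scale c y) = cnj c * t x y"
      by (subst decomp)
        (simp add: t_def complex_eq_iff B_add_right B_real_right comm_i scale_right_distrib
          B_i_i2 algebra_simps del: scale_scale)
    have "B x x = q x" using par[of x x] by (simp add: B_def q0)
    then show "t x x \<in> \<real>" "0 \<le> Re (t x x)"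
      by (simp_all add: t_def complex_is_Real_iff B_diag_i nonneg)
  qed
  moreover have "quad t x = q x" for x
    using par[of x x] by (simp add: quad_def t_def B_def q0)
  ultimately show ?thesis by blast
qed

lemma quadratic_the_form:
  assumes "quadratic q"
  shows "is_form scale (THE u. is_form scale u \<and> (\<forall>x. quad u x = q x))"
    and "quad (THE u. is_form scale u \<and> (\<forall>x. quad u x = q x)) x = q x"
proof -
  have "\<exists>!u. is_form scale u \<and> (\<forall>x. quad u x = q x)"
    using jordan_von_neumann[OF assms] form_eqI by (metis (full_types))
  from theI'[OF this]
  show "is_form scale (THE u. is_form scale u \<and> (\<forall>x. quad u x = q x))"
    "quad (THE u. is_form scale u \<and> (\<forall>x. quad u x = q x)) x = q x" by auto
qed

subsection \<open>Parallel sums\<close>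

lemma parallel_bdd:
  "is_form scale t \<Longrightarrow> is_form scale u \<Longrightarrow> bdd_below (range (\<lambda>y. quad t (x - y) + quad u y))"
  by (rule bdd_belowI[where m = 0]) (auto simp: quad_nonneg)

text \<open>Transforming the competitors \<open>y\<close> in the infimum gives one inequality for
  homogeneity and one for the parallelogram law. Each implies its own converse: apply the first to
  the inverse scalar, the second to \<open>x + y\<close> and \<open>x - y\<close>, whose sum and
  difference are \<open>2 x\<close> and \<open>2 y\<close>.\<close>

lemma quadratic_parallel:
  assumes t: "is_form scale t" and u: "is_form scale u"
  shows "quadratic (\<lambda>x. INF y. quad t (x - y) + quad u y)"
proof -
  define f where "f x = (INF y. quad t (x - y) + quad u y)" for x
  have f_le: "f x \<le> quad t (x - y) + quad u y" for x y
    unfolding f_def by (rule cINF_lower[OF parallel_bdd[OF t u]]) simp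
  have f_ge: "c \<le> f x" if "\<And>y. c \<le> quad t (x - y) + quad u y" for c x
    unfolding f_def by (rule cINF_greatest) (use that in auto)
  have f_nonneg: "0 \<le> f x" for x
    by (rule f_ge) (simp add: quad_nonneg t u)
  have hom_le: "f (scale c x) \<le> (cmod c)\<^sup>2 * f x" for c x
  proof (cases "c = 0")
    case True
    then show ?thesis using f_le[of 0 0] by (simp add: quad_zero t u)
  next
    case False
    have "f (scale c x) / (cmod c)\<^sup>2 \<le> f x"
    proof (rule f_ge)
      fix y
      show "f (scale c x) / (cmod c)\<^sup>2 \<le> quad t (x - y) + quad u y"
        using f_le[of "scale c x" "scale c y"] False
        unfolding scale_right_diff_distrib[symmetric] quad_scale[OF t] quad_scale[OF u]
        by (simp add: field_simps)
    qed
    then show ?thesis using False by (simp add: field_simps)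
  qed
  have hom: "f (scale c x) = (cmod c)\<^sup>2 * f x" for c x
  proof (cases "c = 0")
    case True
    then show ?thesis using hom_le[of 0 x] f_nonneg[of 0] by simp
  next
    case False
    have "f x \<le> (cmod (1/c))\<^sup>2 * f (scale c x)"
      using hom_le[of "1/c" "scale c x"] False by simp
    then have "(cmod c)\<^sup>2 * f x \<le> f (scale c x)"
      using False by (simp add: norm_divide field_simps)
    then show ?thesis using hom_le[of c x] by simp
  qed
  have par_le: "f (x + y) + f (x - y) \<le> 2 * f x + 2 * f y" for x y
  proof -
    \<comment> \<open>Competitors \<open>a\<close> for \<open>x\<close> and \<open>b\<close> for
      \<open>y\<close> produce the competitors \<open>a + b\<close> and \<open>a - b\<close>, to
      which the parallelogram laws of \<open>t\<close> and \<open>u\<close> apply.\<close>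
    have *: "f (x + y) + f (x - y) \<le>
        2 * (quad t (x - a) + quad u a) + 2 * (quad t (y - b) + quad u b)" for a b
    proof -
      have eq: "x + y - (a + b) = (x - a) + (y - b)" "x - y - (a - b) = (x - a) - (y - b)"
        by simp_all
      show ?thesis
        using add_mono[OF f_le[of "x + y" "a + b"] f_le[of "x - y" "a - b"]]
          quad_parallelogram[OF t, of "x - a" "y - b"] quad_parallelogram[OF u, of a b]
        unfolding eq by simp
    qed
    \<comment> \<open>The infima over \<open>a\<close> and over \<open>b\<close> are taken one after
      the other.\<close>
    have "(f (x + y) + f (x - y) - 2 * (quad t (y - b) + quad u b)) / 2 \<le> f x" for b
      by (rule f_ge) (use * in \<open>simp add: field_simps\<close>)
    then have "(f (x + y) + f (x - y) - 2 * f x) / 2 \<le> f y"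
      by (intro f_ge) (simp add: algebra_simps)
    then show ?thesis by simp
  qed
  have "f (x + y) + f (x - y) = 2 * f x + 2 * f y" for x y
  proof (rule antisym[OF par_le])
    have double: "z + z = scale 2 z" for z
      using scale_left_distrib[of 1 1 z] by simp
    have "f (x + y + (x - y)) + f (x + y - (x - y)) \<le> 2 * f (x + y) + 2 * f (x - y)"
      by (rule par_le)
    moreover have "x + y + (x - y) = scale 2 x" "x + y - (x - y) = scale 2 y"
      by (simp_all add: double[symmetric])
    ultimately show "2 * f x + 2 * f y \<le> f (x + y) + f (x - y)"
      by (simp add: hom)
  qed
  then have "quadratic f" using f_nonneg hom by (simp add: quadratic_def)
  then show ?thesis unfolding f_def .
qed

lemma is_form_parallel: "is_form scale t \<Longrightarrow> is_form scale u \<Longrightarrow> is_form scale (parallel_sum scale t u)"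
  unfolding parallel_sum_def by (rule quadratic_the_form(1)[OF quadratic_parallel])

lemma quad_parallel:
  "is_form scale t \<Longrightarrow> is_form scale u \<Longrightarrow>
    quad (parallel_sum scale t u) x = (INF y. quad t (x - y) + quad u y)"
  unfolding parallel_sum_def by (rule quadratic_the_form(2)[OF quadratic_parallel])

lemma parallel_le:
  "is_form scale t \<Longrightarrow> is_form scale u \<Longrightarrow>
    quad (parallel_sum scale t u) x \<le> quad t (x - y) + quad u y"
  unfolding quad_parallel by (rule cINF_lower[OF parallel_bdd]) simp_all

lemma parallel_ge:
  "is_form scale t \<Longrightarrow> is_form scale u \<Longrightarrow> (\<And>y. c \<le> quad t (x - y) + quad u y) \<Longrightarrow>
    c \<le> quad (parallel_sum scale t u) x"
  by (simp add: quad_parallel cINF_greatest)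

lemma parallel_approx:
  assumes "is_form scale t" "is_form scale u" "0 < e"
  obtains y where "quad t (x - y) + quad u y < quad (parallel_sum scale t u) x + e"
proof -
  have "(INF y. quad t (x - y) + quad u y) < quad (parallel_sum scale t u) x + e"
    using assms by (simp add: quad_parallel)
  then show ?thesis
    using that cINF_less_iff[OF _ parallel_bdd[OF assms(1,2)], of x] by auto
qed

lemma parallel_mono:
  assumes "is_form scale t" "is_form scale t'" "is_form scale u" "is_form scale u'"
    "form_le t t'" "form_le u u'"
  shows "form_le (parallel_sum scale t u) (parallel_sum scale t' u')"
  unfolding form_le_def
proof
  fix x
  show "quad (parallel_sum scale t u) x \<le> quad (parallel_sum scale t' u') x"
  proof (rule parallel_ge[OF assms(2,4)])
    fix y
    show "quad (parallel_sum scale t u) x \<le> quad t' (x - y) + quad u' y"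
      using parallel_le[OF assms(1,3), of x y] form_leD[OF assms(5), of "x - y"]
        form_leD[OF assms(6), of y] by linarith
  qed
qed

lemma parallel_le_left:
  "is_form scale t \<Longrightarrow> is_form scale u \<Longrightarrow> quad (parallel_sum scale t u) x \<le> quad t x"
  using parallel_le[of t u x 0] by (simp add: quad_zero)

lemma parallel_le_right:
  "is_form scale t \<Longrightarrow> is_form scale u \<Longrightarrow> quad (parallel_sum scale t u) x \<le> quad u x"
  using parallel_le[of t u x x] by (simp add: quad_zero)

subsection \<open>The operation D\<close>

abbreviation (input) D_approx where
  "D_approx u t n \<equiv> parallel_sum scale t (form_mult n u)"

lemma D_approx_mono:
  assumes "is_form scale t" "is_form scale u" "m \<le> n"
  shows "quad (D_approx u t m) x \<le> quad (D_approx u t n) x"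
proof -
  have "form_le (form_mult m u) (form_mult n u)"
    using assms by (auto simp: form_le_def quad_mult intro!: mult_right_mono quad_nonneg)
  from parallel_mono[OF assms(1,1) is_form_mult[OF assms(2)] is_form_mult[OF assms(2)] form_le_refl this]
  show ?thesis by (rule form_leD)
qed

lemma D_approx_bdd:
  assumes "is_form scale t" "is_form scale u"
  shows "bdd_above (range (\<lambda>n. quad (D_approx u t n) x))"
  by (rule bdd_aboveI[where M = "quad t x"]) (auto intro: parallel_le_left is_form_mult assms)

lemma D_approx_tendsto_SUP:
  assumes "is_form scale t" "is_form scale u"
  shows "(\<lambda>n. quad (D_approx u t n) x) \<longlonglongrightarrow> (SUP n. quad (D_approx u t n) x)"
  by (intro LIMSEQ_incseq_SUP D_approx_bdd assms) (auto simp: incseq_def intro: D_approx_mono assms)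

text \<open>A supremum need not respect sums, but here it is the limit of an increasing sequence, so
  the identities satisfied by the approximants pass to it.\<close>

lemma quadratic_D:
  assumes t: "is_form scale t" and u: "is_form scale u"
  shows "quadratic (\<lambda>x. SUP n. quad (D_approx u t n) x)"
proof -
  note lim = D_approx_tendsto_SUP[OF t u]
  have form: "is_form scale (D_approx u t n)" for n
    by (intro is_form_parallel is_form_mult t u)
  show ?thesis
    unfolding quadratic_def
  proof (intro conjI allI)
    fix x y c
    show "0 \<le> (SUP n. quad (D_approx u t n) x)"
      by (rule LIMSEQ_le_const[OF lim]) (auto simp: quad_nonneg[OF form])
    have "(\<lambda>n. quad (D_approx u t n) (x + y) + quad (D_approx u t n) (x - y)) \<longlonglongrightarrow>
        (SUP n. quad (D_approx u t n) (x + y)) + (SUP n. quad (D_approx u t n) (x - y))"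
      by (intro tendsto_intros lim)
    moreover have "(\<lambda>n. 2 * quad (D_approx u t n) x + 2 * quad (D_approx u t n) y) \<longlonglongrightarrow>
        2 * (SUP n. quad (D_approx u t n) x) + 2 * (SUP n. quad (D_approx u t n) y)"
      by (intro tendsto_intros lim)
    ultimately show "(SUP n. quad (D_approx u t n) (x + y)) + (SUP n. quad (D_approx u t n) (x - y)) =
        2 * (SUP n. quad (D_approx u t n) x) + 2 * (SUP n. quad (D_approx u t n) y)"
      unfolding quad_parallelogram[OF form] by (rule LIMSEQ_unique)
    have "(\<lambda>n. (cmod c)\<^sup>2 * quad (D_approx u t n) x) \<longlonglongrightarrow> (cmod c)\<^sup>2 * (SUP n. quad (D_approx u t n) x)"
      by (intro tendsto_intros lim)
    with lim[of "scale c x"]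
    show "(SUP n. quad (D_approx u t n) (scale c x)) = (cmod c)\<^sup>2 * (SUP n. quad (D_approx u t n) x)"
      unfolding quad_scale[OF form] by (rule LIMSEQ_unique)
  qed
qed

lemma is_form_D: "is_form scale t \<Longrightarrow> is_form scale u \<Longrightarrow> is_form scale (form_D scale u t)"
  unfolding form_D_def by (rule quadratic_the_form(1)[OF quadratic_D])

lemma quad_D:
  "is_form scale t \<Longrightarrow> is_form scale u \<Longrightarrow>
    quad (form_D scale u t) x = (SUP n. quad (D_approx u t n) x)"
  unfolding form_D_def by (rule quadratic_the_form(2)[OF quadratic_D])

lemma D_approx_tendsto:
  "is_form scale t \<Longrightarrow> is_form scale u \<Longrightarrow>
    (\<lambda>n. quad (D_approx u t n) x) \<longlonglongrightarrow> quad (form_D scale u t) x"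
  by (simp add: quad_D D_approx_tendsto_SUP)

lemma D_approx_le_D:
  "is_form scale t \<Longrightarrow> is_form scale u \<Longrightarrow> quad (D_approx u t n) x \<le> quad (form_D scale u t) x"
  unfolding quad_D by (rule cSUP_upper[OF _ D_approx_bdd]) simp_all

lemma D_le:
  "is_form scale t \<Longrightarrow> is_form scale u \<Longrightarrow> (\<And>n. quad (D_approx u t n) x \<le> c) \<Longrightarrow>
    quad (form_D scale u t) x \<le> c"
  by (simp add: quad_D cSUP_least)

lemma D_le_self: "is_form scale t \<Longrightarrow> is_form scale u \<Longrightarrow> form_le (form_D scale u t) t"
  unfolding form_le_def by (auto intro: D_le parallel_le_left is_form_mult)

text \<open>The factor \<open>k\<close> is harmless because \<open>n * k\<close> is just another
  index in the supremum defining the right side.\<close>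

lemma D_mono:
  assumes "is_form scale t" "is_form scale t'" "is_form scale u" "is_form scale u'"
    and "form_le t t'" and "\<And>x. quad u x \<le> real k * quad u' x"
  shows "form_le (form_D scale u t) (form_D scale u' t')"
  unfolding form_le_def
proof (intro allI D_le assms(1,3))
  fix x n
  have "form_le (form_mult n u) (form_mult (n * k) u')"
    using assms(6) by (auto simp: form_le_def quad_mult mult.assoc intro!: mult_left_mono)
  from parallel_mono[OF assms(1,2) is_form_mult[OF assms(3)] is_form_mult[OF assms(4)] assms(5) this]
  show "quad (D_approx u t n) x \<le> quad (form_D scale u' t') x"
    using D_approx_le_D[OF assms(2,4), of "n * k" x] by (meson form_leD order_trans)
qed

text \<open>Splitting \<open>x\<close> as \<open>(x - y) + y\<close> and using
  \<open>quad_add_weighted\<close> for \<open>r\<close> bounds the \<open>n\<close>-th approximant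
  below by n/(n+1) times \<open>r\<close>; then \<open>n\<close> tends to infinity. This maximality
  of \<open>form_D scale u t\<close> among common lower bounds is the source of the meet.\<close>

lemma le_D:
  assumes r: "is_form scale r" and t: "is_form scale t" and u: "is_form scale u"
    and rt: "form_le r t" and ru: "form_le r u"
  shows "form_le r (form_D scale u t)"
  unfolding form_le_def
proof
  fix x
  have bound: "real n / (real n + 1) * quad r x \<le> quad (D_approx u t n) x" for n
  proof (rule parallel_ge[OF t is_form_mult[OF u]])
    fix y
    have "real n * quad r x \<le> (real n + 1) * (quad r (x - y) + real n * quad r y)"
      using quad_add_weighted[OF r, of n "x - y" y] by simp
    also have "\<dots> \<le> (real n + 1) * (quad t (x - y) + real n * quad u y)"
      using rt ru by (auto intro!: mult_left_mono add_mono simp: form_le_def)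
    finally show "real n / (real n + 1) * quad r x \<le> quad t (x - y) + quad (form_mult n u) y"
      by (simp add: quad_mult field_simps)
  qed
  have "(\<lambda>n. real n / real (Suc n) * quad r x) \<longlonglongrightarrow> 1 * quad r x"
    by (intro tendsto_intros LIMSEQ_n_over_Suc_n)
  then show "quad r x \<le> quad (form_D scale u t) x"
    using LIMSEQ_le[OF _ D_approx_tendsto[OF t u, of x], of _ "quad r x"] bound
    by (simp add: add.commute)
qed

text \<open>Take near-minimizers for the weight \<open>Suc n\<close> with error
  \<open>inverse (real (Suc n))\<close>. Dropping the \<open>u\<close> term gives the first claim;
  dropping the \<open>w\<close> term and dividing by the weight, which is never 0, gives the
  second.\<close>

lemma D_minimizing_seq:
  assumes w: "is_form scale w" and u: "is_form scale u"
  obtains y where "\<And>n. quad w (x - y n) \<le> quad (form_D scale u w) x + inverse (real (Suc n))"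
    and "(\<lambda>n. quad u (y n)) \<longlonglongrightarrow> 0"
proof -
  let ?j = "quad (form_D scale u w) x"
  have "\<exists>y. quad w (x - y) + real (Suc n) * quad u y \<le> ?j + inverse (real (Suc n))" for n
  proof -
    obtain y where "quad w (x - y) + quad (form_mult (Suc n) u) y
        < quad (D_approx u w (Suc n)) x + inverse (real (Suc n))"
      by (rule parallel_approx[OF w is_form_mult[OF u], of "inverse (real (Suc n))"]) auto
    then show ?thesis
      using D_approx_le_D[OF w u, of "Suc n" x] unfolding quad_mult
      by (intro exI[of _ y]) linarith
  qed
  then obtain y where y: "\<And>n. quad w (x - y n) + real (Suc n) * quad u (y n) \<le> ?j + inverse (real (Suc n))"
    by metis
  have w_le: "quad w (x - y n) \<le> ?j + inverse (real (Suc n))" for n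
    using y[of n] mult_nonneg_nonneg[OF of_nat_0_le_iff quad_nonneg[OF u, of "y n"], of "Suc n"]
    by linarith
  have u_le: "quad u (y n) \<le> (?j + 1) * inverse (real (Suc n))" for n
  proof -
    have "inverse (real (Suc n)) \<le> 1"
      by (simp add: field_simps)
    then have "real (Suc n) * quad u (y n) \<le> ?j + 1"
      using y[of n] quad_nonneg[OF w, of "x - y n"] by linarith
    then show ?thesis by (simp add: field_simps)
  qed
  have upper: "(\<lambda>n. (?j + 1) * inverse (real (Suc n))) \<longlonglongrightarrow> 0"
    by (rule tendsto_mult_right_zero[OF LIMSEQ_inverse_real_of_nat])
  have "(\<lambda>n. quad u (y n)) \<longlonglongrightarrow> 0"
    by (rule LIMSEQ_null_squeeze[OF upper]) (rule quad_nonneg[OF u], rule u_le)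
  with w_le show ?thesis by (rule that)
qed

subsection \<open>Quasi-units\<close>

lemma quasi_unitD:
  assumes "t \<in> quasi_units scale w"
  shows "is_form scale t" "form_le t w" "form_D scale t w = t"
  using assms by (auto simp: quasi_units_def)

text \<open>For a minimizing sequence \<open>z\<close> of \<open>form_D scale t w = t\<close>, the
  sequence \<open>x - z n\<close> works: its \<open>w\<close> values are at most
  \<open>quad t x\<close> plus a null sequence, while its \<open>t\<close> values tend to
  \<open>quad t x\<close>.\<close>

lemma quasi_unit_approx:
  assumes w: "is_form scale w" and qu: "t \<in> quasi_units scale w"
  obtains y where "(\<lambda>n. quad t (x - y n)) \<longlonglongrightarrow> 0" "(\<lambda>n. quad w (y n) - quad t (y n)) \<longlonglongrightarrow> 0"
proof -
  note t = quasi_unitD[OF qu]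
  obtain z where z: "\<And>n. quad w (x - z n) \<le> quad t x + inverse (real (Suc n))"
    and lim: "(\<lambda>n. quad t (z n)) \<longlonglongrightarrow> 0"
    using D_minimizing_seq[OF w t(1), of x] unfolding t(3) by metis
  let ?y = "\<lambda>n. x - z n"
  have lim0: "(\<lambda>n. quad t (x - ?y n)) \<longlonglongrightarrow> 0" using lim by simp
  have "(\<lambda>n. quad t x + inverse (real (Suc n)) - quad t (?y n)) \<longlonglongrightarrow> quad t x + 0 - quad t x"
    by (intro tendsto_intros LIMSEQ_inverse_real_of_nat quad_tendsto[OF t(1) lim0])
  then have upper: "(\<lambda>n. quad t x + inverse (real (Suc n)) - quad t (?y n)) \<longlonglongrightarrow> 0" by simp
  have "(\<lambda>n. quad w (?y n) - quad t (?y n)) \<longlonglongrightarrow> 0"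
    by (rule LIMSEQ_null_squeeze[OF upper])
      (use z form_leD[OF t(2)] in auto)
  with lim0 show ?thesis by (rule that)
qed

text \<open>For fixed \<open>n\<close>, the competitor \<open>x - y k\<close> bounds the approximant
  at \<open>x\<close> by \<open>quad w (y k) + n * quad t (x - y k)\<close>, which tends to
  \<open>quad t x\<close>. Hence \<open>form_D scale t w\<close> lies below \<open>t\<close>; the
  reverse is \<open>le_D\<close>.\<close>

lemma quasi_unitI_approx:
  assumes w: "is_form scale w" and t: "is_form scale t" and tw: "form_le t w"
    and approx: "\<And>x. \<exists>y. (\<lambda>n. quad t (x - y n)) \<longlonglongrightarrow> 0 \<and> (\<lambda>n. quad w (y n) - quad t (y n)) \<longlonglongrightarrow> 0"
  shows "t \<in> quasi_units scale w"
proof -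
  have "form_le (form_D scale t w) t"
    unfolding form_le_def
  proof (intro allI D_le[OF w t])
    fix x n
    obtain y where y: "(\<lambda>k. quad t (x - y k)) \<longlonglongrightarrow> 0" "(\<lambda>k. quad w (y k) - quad t (y k)) \<longlonglongrightarrow> 0"
      using approx by blast
    have "(\<lambda>k. quad t (y k) + (quad w (y k) - quad t (y k)) + real n * quad t (x - y k))
        \<longlonglongrightarrow> quad t x + 0 + real n * 0"
      by (intro tendsto_intros y quad_tendsto[OF t y(1)])
    moreover have "quad (D_approx t w n) x \<le>
        quad t (y k) + (quad w (y k) - quad t (y k)) + real n * quad t (x - y k)" for k
      using parallel_le[OF w is_form_mult[OF t], of n x "x - y k"] by (simp add: quad_mult)
    ultimately show "quad (D_approx t w n) x \<le> quad t x"
      using LIMSEQ_le_const by fastforce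
  qed
  moreover have "form_le t (form_D scale t w)"
    by (rule le_D[OF t w t tw form_le_refl])
  ultimately have "form_D scale t w = t"
    by (intro form_le_antisym is_form_D w t)
  then show ?thesis using t tw by (simp add: quasi_units_def)
qed

text \<open>Each approximant is bounded by a multiple of \<open>u\<close> and so is continuous along
  \<open>v\<close>; a supremum of such forms is lower semicontinuous.\<close>

lemma D_semicontinuous:
  assumes w: "is_form scale w" and u: "is_form scale u"
    and lim: "(\<lambda>n. quad u (x - v n)) \<longlonglongrightarrow> 0" and e: "0 < e"
  shows "eventually (\<lambda>n. quad (form_D scale u w) x - e < quad (form_D scale u w) (v n)) sequentially"
proof -
  let ?j = "form_D scale u w"
  have "eventually (\<lambda>k. quad ?j x - e < quad (D_approx u w k) x) sequentially"
    using order_tendstoD(1)[OF D_approx_tendsto[OF w u, of x], of "quad ?j x - e"] e by simp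
  then obtain k where k: "quad ?j x - e < quad (D_approx u w k) x"
    by (auto simp: eventually_sequentially)
  have form: "is_form scale (D_approx u w k)"
    by (intro is_form_parallel is_form_mult w u)
  have upper: "(\<lambda>n. real k * quad u (x - v n)) \<longlonglongrightarrow> 0"
    by (rule tendsto_mult_right_zero[OF lim])
  have "(\<lambda>n. quad (D_approx u w k) (x - v n)) \<longlonglongrightarrow> 0"
    by (rule LIMSEQ_null_squeeze[OF upper])
      (rule quad_nonneg[OF form], rule parallel_le_right[OF w is_form_mult[OF u], of k, unfolded quad_mult])
  then have "(\<lambda>n. quad (D_approx u w k) (v n)) \<longlonglongrightarrow> quad (D_approx u w k) x"
    by (rule quad_tendsto[OF form])
  from order_tendstoD(1)[OF this k] show ?thesis
    by eventually_elim (use D_approx_le_D[OF w u, of k] in \<open>blast intro: less_le_trans\<close>)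
qed

text \<open>The argument of the projection theorem. Along \<open>z n = x - y n\<close> the values of
  \<open>w\<close>, and hence of \<open>j\<close>, are asymptotically at most
  \<open>quad j x\<close>. Semicontinuity bounds \<open>j\<close> from below at \<open>z n\<close>
  and at the midpoint of \<open>x\<close> and \<open>z n\<close>, and the parallelogram law turns
  this into convergence.\<close>

lemma D_quasi_unit:
  assumes w: "is_form scale w" and u: "is_form scale u"
  shows "form_D scale u w \<in> quasi_units scale w"
proof -
  define j where "j = form_D scale u w"
  have j: "is_form scale j" unfolding j_def by (rule is_form_D[OF w u])
  have jw: "form_le j w" unfolding j_def by (rule D_le_self[OF w u])
  note lsc = D_semicontinuous[OF w u, folded j_def]
  show ?thesis
    unfolding j_def[symmetric]
  proof (rule quasi_unitI_approx[OF w j jw])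
    fix x
    obtain y where y: "\<And>n. quad w (x - y n) \<le> quad j x + inverse (real (Suc n))"
      and lim: "(\<lambda>n. quad u (y n)) \<longlonglongrightarrow> 0"
      using D_minimizing_seq[OF w u, of x] unfolding j_def by metis
    define z where "z n = x - y n" for n
    have lim_z: "(\<lambda>n. quad u (x - z n)) \<longlonglongrightarrow> 0" using lim by (simp add: z_def)
    have "(\<lambda>n. (cmod (1/2))\<^sup>2 * quad u (y n)) \<longlonglongrightarrow> 0"
      by (rule tendsto_mult_right_zero[OF lim])
    then have lim_mid: "(\<lambda>n. quad u (x - (x - scale (1/2) (y n)))) \<longlonglongrightarrow> 0"
      by (simp add: quad_scale[OF u])
    \<comment> \<open>The midpoint of \<open>x\<close> and \<open>z n\<close> is \<open>x\<close>
      minus half of \<open>y n\<close>.\<close>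
    have par: "quad j (x - z n) = 2 * quad j x + 2 * quad j (z n) - 4 * quad j (x - scale (1/2) (y n))" for n
    proof -
      have "x + z n = scale 2 (x - scale (1/2) (y n))"
        using scale_left_distrib[of 1 1 x]
        by (simp add: z_def scale_right_diff_distrib algebra_simps)
      then show ?thesis
        using quad_parallelogram[OF j, of x "z n"] by (simp add: quad_scale[OF j])
    qed
    have w_z: "quad w (z n) \<le> quad j x + inverse (real (Suc n))" for n
      using y by (simp add: z_def)
    have j_z: "quad j (z n) \<le> quad w (z n)" for n by (rule form_leD[OF jw])
    have small: "eventually (\<lambda>n. inverse (real (Suc n)) < e) sequentially" if "0 < e" for e
      by (rule order_tendstoD(2)[OF LIMSEQ_inverse_real_of_nat that])
    have "(\<lambda>n. quad j (x - z n)) \<longlonglongrightarrow> 0"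
    proof (rule order_tendstoI)
      fix a :: real assume "a < 0"
      then show "eventually (\<lambda>n. a < quad j (x - z n)) sequentially"
        by (auto intro!: always_eventually less_le_trans[OF _ quad_nonneg[OF j]])
    next
      fix a :: real assume "0 < a"
      \<comment> \<open>In \<open>par\<close> the errors add up to 2 (a/8) from \<open>z n\<close>
        and 4 (a/8) from the midpoint, and 3a/4 is less than \<open>a\<close>.\<close>
      then have "0 < a / 8" by simp
      from lsc[OF lim_mid this] small[OF this]
      show "eventually (\<lambda>n. quad j (x - z n) < a) sequentially"
      proof eventually_elim
        case (elim n)
        then show ?case using w_z[of n] j_z[of n] \<open>0 < a\<close> unfolding par[of n] by linarith
      qed
    qed
    moreover have "(\<lambda>n. quad w (z n) - quad j (z n)) \<longlonglongrightarrow> 0"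
    proof (rule order_tendstoI)
      fix a :: real assume "a < 0"
      then show "eventually (\<lambda>n. a < quad w (z n) - quad j (z n)) sequentially"
        by (intro always_eventually allI, rule less_le_trans[of a 0]) (simp_all add: j_z)
    next
      fix a :: real assume "0 < a"
      then have "0 < a / 2" by simp
      from lsc[OF lim_z this] small[OF this]
      show "eventually (\<lambda>n. quad w (z n) - quad j (z n) < a) sequentially"
      proof eventually_elim
        case (elim n)
        then show ?case using w_z[of n] by simp
      qed
    qed
    ultimately show "\<exists>y. (\<lambda>n. quad j (x - y n)) \<longlonglongrightarrow> 0 \<and> (\<lambda>n. quad w (y n) - quad j (y n)) \<longlonglongrightarrow> 0"
      by blast
  qed
qed

section \<open>Meets and joins of quasi-units\<close>

lemma D_least_quasi_unit:
  assumes w: "is_form scale w" and u: "is_form scale u" and r: "r \<in> quasi_units scale w"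
    and le: "\<And>x. quad u x \<le> real k * quad r x"
  shows "form_le (form_D scale u w) r"
  using D_mono[OF w w u quasi_unitD(1)[OF r] form_le_refl le] quasi_unitD(3)[OF r] by simp

lemma D_glb:
  assumes w: "is_form scale w" and s: "s \<in> quasi_units scale w" and t: "t \<in> quasi_units scale w"
  shows "form_le (form_D scale s t) s" "form_le (form_D scale s t) t"
    "is_form scale r \<Longrightarrow> form_le r s \<Longrightarrow> form_le r t \<Longrightarrow> form_le r (form_D scale s t)"
    "form_D scale s t \<in> quasi_units scale w"
proof -
  note s' = quasi_unitD[OF s] and t' = quasi_unitD[OF t]
  let ?e = "form_D scale s t"
  have e: "is_form scale ?e" by (rule is_form_D[OF t'(1) s'(1)])
  have "form_le ?e (form_D scale s w)"
    by (rule D_mono[OF t'(1) w s'(1) s'(1) t'(2), of 1]) simp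
  then show es: "form_le ?e s" by (simp add: s'(3))
  show et: "form_le ?e t" by (rule D_le_self[OF t'(1) s'(1)])
  show glb: "form_le r ?e" if "is_form scale r" "form_le r s" "form_le r t" for r
    by (rule le_D[OF that(1) t'(1) s'(1) that(3,2)])
  \<comment> \<open>As \<open>?e\<close> lies below \<open>s\<close> and \<open>t\<close>,
    monotonicity puts \<open>form_D scale ?e w\<close> below D_s w = s and D_t w = t, so it is a
    common lower bound to which \<open>glb\<close> applies.\<close>
  have "form_le (form_D scale ?e w) s" "form_le (form_D scale ?e w) t"
    using D_least_quasi_unit[OF w e s, of 1] D_least_quasi_unit[OF w e t, of 1] form_leD[OF es] form_leD[OF et]
    by simp_all
  then have "form_le (form_D scale ?e w) ?e" by (intro glb is_form_D w e)
  moreover have "form_le ?e (form_D scale ?e w)"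
    by (rule le_D[OF e w e form_le_trans[OF es s'(2)] form_le_refl])
  ultimately have "form_D scale ?e w = ?e" by (intro form_le_antisym is_form_D w e)
  then show "?e \<in> quasi_units scale w"
    using e form_le_trans[OF es s'(2)] by (simp add: quasi_units_def)
qed

text \<open>The estimate of \<open>2 * quad ?p\<close> by \<open>w\<close> is transferred to
  \<open>e\<close>: on the range of the projection belonging to \<open>e\<close> the forms
  \<open>w\<close> and \<open>e\<close> agree, and \<open>?p\<close> vanishes on the complement
  because it lies below \<open>e\<close>.\<close>

lemma twice_parallel_le:
  assumes w: "is_form scale w" and s: "is_form scale s" "form_le s w" and t: "is_form scale t" "form_le t w"
    and e: "e \<in> quasi_units scale w" and le: "form_le (parallel_sum scale s t) e"
  shows "2 * quad (parallel_sum scale s t) x \<le> quad e x"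
proof -
  let ?p = "parallel_sum scale s t"
  note e' = quasi_unitD[OF e]
  have p: "is_form scale ?p" by (rule is_form_parallel[OF s(1) t(1)])
  have p_le: "2 * quad ?p y \<le> quad w y" for y
  proof -
    have "y - scale (1/2) y = scale (1/2) y"
      using scale_left_distrib[of "1/2" "1/2" y] by (simp add: algebra_simps)
    then have "quad ?p y \<le> quad s y / 4 + quad t y / 4"
      using parallel_le[OF s(1) t(1), of y "scale (1/2) y"]
      by (simp add: quad_scale s(1) t(1) norm_divide power2_eq_square)
    then show ?thesis using form_leD[OF s(2), of y] form_leD[OF t(2), of y] by simp
  qed
  obtain y where y: "(\<lambda>n. quad e (x - y n)) \<longlonglongrightarrow> 0" "(\<lambda>n. quad w (y n) - quad e (y n)) \<longlonglongrightarrow> 0"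
    by (rule quasi_unit_approx[OF w e])
  have "(\<lambda>n. quad ?p (x - y n)) \<longlonglongrightarrow> 0"
    by (rule LIMSEQ_null_squeeze[OF y(1)])
      (rule quad_nonneg[OF p], rule form_leD[OF le])
  then have "(\<lambda>n. 2 * quad ?p (y n)) \<longlonglongrightarrow> 2 * quad ?p x"
    by (intro tendsto_intros quad_tendsto[OF p])
  moreover have "(\<lambda>n. quad e (y n) + (quad w (y n) - quad e (y n))) \<longlonglongrightarrow> quad e x + 0"
    by (intro tendsto_intros quad_tendsto[OF e'(1)] y)
  ultimately show ?thesis
    using LIMSEQ_le[of "\<lambda>n. 2 * quad ?p (y n)"] p_le by fastforce
qed

lemma D_eq_twice_parallel:
  assumes w: "is_form scale w" and s: "s \<in> quasi_units scale w" and t: "t \<in> quasi_units scale w"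
  shows "form_D scale s t = form_mult 2 (parallel_sum scale s t)"
proof -
  note s' = quasi_unitD[OF s] and t' = quasi_unitD[OF t]
  let ?e = "form_D scale s t" and ?p = "parallel_sum scale s t"
  note glb = D_glb[OF w s t]
  have e: "is_form scale ?e" and p: "is_form scale ?p"
    by (rule is_form_D[OF t'(1) s'(1)], rule is_form_parallel[OF s'(1) t'(1)])
  have "form_le ?p ?e"
    by (rule glb(3)[OF p]) (auto simp: form_le_def parallel_le_left parallel_le_right s'(1) t'(1))
  then have "form_le (form_mult 2 ?p) ?e"
    using twice_parallel_le[OF w s'(1,2) t'(1,2) glb(4)] by (simp add: form_le_def quad_mult)
  moreover have "form_le ?e (form_mult 2 ?p)"
    unfolding form_le_def
  proof
    fix x
    \<comment> \<open>For every splitting of \<open>x\<close>, \<open>?e\<close> is at most twice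
      the sum over the two parts, and it lies below \<open>s\<close> on one and below
      \<open>t\<close> on the other.\<close>
    have "quad ?e x / 2 \<le> quad ?p x"
    proof (rule parallel_ge[OF s'(1) t'(1)])
      fix y
      show "quad ?e x / 2 \<le> quad s (x - y) + quad t y"
        using quad_add_le[OF e, of "x - y" y] form_leD[OF glb(1), of "x - y"] form_leD[OF glb(2), of y]
        by simp
    qed
    then show "quad ?e x \<le> quad (form_mult 2 ?p) x" by (simp add: quad_mult)
  qed
  ultimately show ?thesis by (intro form_le_antisym e is_form_mult p)
qed

lemma D_add_lub:
  assumes w: "is_form scale w" and s: "s \<in> quasi_units scale w" and t: "t \<in> quasi_units scale w"
  shows "form_D scale (form_add s t) w \<in> quasi_units scale w"
    "form_le s (form_D scale (form_add s t) w)" "form_le t (form_D scale (form_add s t) w)"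
    "r \<in> quasi_units scale w \<Longrightarrow> form_le s r \<Longrightarrow> form_le t r \<Longrightarrow>
      form_le (form_D scale (form_add s t) w) r"
proof -
  note s' = quasi_unitD[OF s] and t' = quasi_unitD[OF t]
  have u: "is_form scale (form_add s t)" by (rule is_form_add[OF s'(1) t'(1)])
  show "form_D scale (form_add s t) w \<in> quasi_units scale w" by (rule D_quasi_unit[OF w u])
  have "form_le s (form_add s t)" "form_le t (form_add s t)"
    by (simp_all add: form_le_def quad_add quad_nonneg s'(1) t'(1))
  then show "form_le s (form_D scale (form_add s t) w)" "form_le t (form_D scale (form_add s t) w)"
    by (simp_all add: le_D[OF s'(1) w u s'(2)] le_D[OF t'(1) w u t'(2)])
  show "form_le (form_D scale (form_add s t) w) r"
    \<comment> \<open>The sum \<open>s + t\<close> is bounded by \<open>2 r\<close> rather than by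
      \<open>r\<close>; \<open>form_D\<close> absorbs the factor 2.\<close>
    if r: "r \<in> quasi_units scale w" and le: "form_le s r" "form_le t r"
  proof (rule D_least_quasi_unit[OF w u r, of 2])
    fix x
    show "quad (form_add s t) x \<le> real 2 * quad r x"
      using form_leD[OF le(1), of x] form_leD[OF le(2), of x] by (simp add: quad_add)
  qed
qed

subsection \<open>The order structures\<close>

lemma partial_order_form_le:
  assumes "\<And>t. t \<in> A \<Longrightarrow> is_form scale t"
  shows "partial_order \<lparr>carrier = A, eq = (=), le = form_le\<rparr>"
  by (rule partial_order.intro, unfold_locales)
    (auto simp: form_le_refl intro: form_le_trans form_le_antisym assms)

lemma partial_order_quasi_units: "partial_order (quasi_unit_order scale w)"
  unfolding quasi_unit_order_def by (rule partial_order_form_le) (rule quasi_unitD(1))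

lemma partial_order_forms: "partial_order (form_order scale)"
  unfolding form_order_def by (rule partial_order_form_le) simp

end

text \<open>The library meet is a choice among greatest lower bounds; antisymmetry leaves a single
  candidate.\<close>

lemma (in partial_order) meet_eqI: "greatest L g (Lower L {x, y}) \<Longrightarrow> x \<sqinter> y = g"
  unfolding meet_def inf_def by (rule some_equality) (auto intro: weak_greatest_unique[unfolded eq_is_equal])

lemma (in partial_order) join_eqI: "least L g (Upper L {x, y}) \<Longrightarrow> x \<squnion> y = g"
  unfolding join_def sup_def by (rule some_equality) (auto intro: weak_least_unique[unfolded eq_is_equal])

theorem theorem13:
  fixes scale :: "complex \<Rightarrow> 'a \<Rightarrow> 'a::ab_group_add"
    and w :: "'a sform"
  assumes "vector_space scale"
    and "is_form scale w"
  shows "Lattice.lattice (quasi_unit_order scale w) \<and>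
    (\<forall>s \<in> quasi_units scale w. \<forall>t \<in> quasi_units scale w.
       greatest (quasi_unit_order scale w) (s \<sqinter>\<^bsub>quasi_unit_order scale w\<^esub> t)
         (Lower (quasi_unit_order scale w) {s, t}) \<and>
       least (quasi_unit_order scale w) (s \<squnion>\<^bsub>quasi_unit_order scale w\<^esub> t)
         (Upper (quasi_unit_order scale w) {s, t}) \<and>
       greatest (form_order scale) (s \<sqinter>\<^bsub>form_order scale\<^esub> t)
         (Lower (form_order scale) {s, t}) \<and>
       s \<sqinter>\<^bsub>quasi_unit_order scale w\<^esub> t = form_mult 2 (parallel_sum scale s t) \<and>
       s \<squnion>\<^bsub>quasi_unit_order scale w\<^esub> t = form_D scale (form_add s t) w \<and>
       s \<sqinter>\<^bsub>quasi_unit_order scale w\<^esub> t = s \<sqinter>\<^bsub>form_order scale\<^esub> t \<and>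
       s \<sqinter>\<^bsub>form_order scale\<^esub> t = form_D scale s t \<and>
       form_D scale s t = form_D scale t s)"
proof -
  interpret vector_space scale by fact
  interpret complex_space scale ..
  note w = \<open>is_form scale w\<close>
  let ?Q = "quasi_unit_order scale w" and ?F = "form_order scale"
  interpret Q: partial_order ?Q by (rule partial_order_quasi_units)
  interpret F: partial_order ?F by (rule partial_order_forms)
  have carrier_Q: "carrier ?Q = quasi_units scale w" and le_Q: "le ?Q = form_le"
    and carrier_F: "carrier ?F = {t. is_form scale t}" and le_F: "le ?F = form_le"
    by (simp_all add: quasi_unit_order_def form_order_def)
  have meet_Q: "greatest ?Q (form_D scale s t) (Lower ?Q {s, t})"
    and meet_F: "greatest ?F (form_D scale s t) (Lower ?F {s, t})"
    and join_Q: "least ?Q (form_D scale (form_add s t) w) (Upper ?Q {s, t})"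
    if "s \<in> quasi_units scale w" "t \<in> quasi_units scale w" for s t
    using that D_glb[OF w that] D_add_lub[OF w that] quasi_unitD(1)
    by (auto simp: greatest_def least_def Lower_def Upper_def carrier_Q le_Q carrier_F le_F)
  have "Lattice.lattice ?Q"
    by unfold_locales (use meet_Q join_Q carrier_Q in blast)+
  \<comment> \<open>Both sides are the meet, among all forms, of the same unordered pair.\<close>
  moreover have "form_D scale s t = form_D scale t s"
    if "s \<in> quasi_units scale w" "t \<in> quasi_units scale w" for s t
    using F.meet_eqI[OF meet_F[OF that]] F.meet_eqI[OF meet_F[OF that(2,1)]]
    by (simp add: meet_def insert_commute)
  moreover have "s \<sqinter>\<^bsub>?Q\<^esub> t = form_D scale s t" "s \<sqinter>\<^bsub>?F\<^esub> t = form_D scale s t"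
    "s \<squnion>\<^bsub>?Q\<^esub> t = form_D scale (form_add s t) w"
    if "s \<in> quasi_units scale w" "t \<in> quasi_units scale w" for s t
    using Q.meet_eqI[OF meet_Q[OF that]] F.meet_eqI[OF meet_F[OF that]] Q.join_eqI[OF join_Q[OF that]]
    by auto
  ultimately show ?thesis
    using meet_Q meet_F join_Q by (auto simp: D_eq_twice_parallel[OF w, symmetric])
qed

end
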